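(* Let $(G,\mu)$ be a countable measured group and suppose $(X,\nu)$ is a compact minimal $(G,\mu)$-space such that $\sigma_\nu(s,\cdot)$ is continuous for every $s\in G$. If $\nu$ is not $G$-invariant, then for every $\varepsilon>0$ there exists an integer $n$ such that $$\sup_{x\in X}\int_G\sigma_\nu(s,x)^{1-2\varepsilon}\,d\mu^{*n}(s)<1.$$
   Context: A measured group $(G,\mu)$ is a countable group $G$ with a probability measure $\mu$ whose support generates $G$ as a semigroup; $\mu^{*n}$ is the $n$-th convolution power of $\mu$. A compact $(G,\mu)$-space $(X,\nu)$ is a compact metrizable space $X$ with an action of $G$ by homeomorphisms and a Borel probability measure $\nu$, whose measure class is preserved by $G$, such that $\int_G\int_X\phi(s^{-1}x)\,d\nu(x)\,d\mu(s)=\int_X\phi\,d\nu$ for all $\phi\in C(X)$. It is minimal if every $G$-orbit is dense in $X$. $\sigma_\nu(s,x)=\frac{ds^{-1}\nu}{d\nu}(x)$ is the Radon–Nikodym derivative, where $s^{-1}\nu$ is the push-forward of $\nu$ under $x\mapsto s^{-1}x$. The hypothesis that $\sigma_\nu(s,\cdot)$ is continuous means that it has a continuous representative, and $\sigma_\nu(s,\cdot)$ denotes this representative.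
   Formalization: The claim is proved for 0 < ε < 1/2 only; for ε = 1/2 the integral is identically 1, and for ε > 1/2 Jensen's inequality makes it at least 1 at every x, so the printed claim "for every ε > 0" fails there. *)

theory Defs
  imports "HOL-Probability.Probability" "HOL-Algebra.Group_Action"
begin

inductive_set semigroup_generated :: "('g, 'b) monoid_scheme \<Rightarrow> 'g set \<Rightarrow> 'g set"
  for G (structure) and S where
  base: "s \<in> S \<Longrightarrow> s \<in> semigroup_generated G S"
| mult: "s \<in> semigroup_generated G S \<Longrightarrow> t \<in> semigroup_generated G S
    \<Longrightarrow> s \<otimes> t \<in> semigroup_generated G S"

locale measured_group = group G for G :: "('g, 'b) monoid_scheme" (structure) +
  fixes \<mu> :: "'g pmf"
  assumes countable_carrier: "countable (carrier G)"
    and support_subset: "set_pmf \<mu> \<subseteq> carrier G"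
    and support_generates: "semigroup_generated G (set_pmf \<mu>) = carrier G"

definition convolution :: "('g, 'b) monoid_scheme \<Rightarrow> 'g pmf \<Rightarrow> 'g pmf \<Rightarrow> 'g pmf" where
  "convolution G \<mu> \<eta> = map_pmf (\<lambda>(s, t). s \<otimes>\<^bsub>G\<^esub> t) (pair_pmf \<mu> \<eta>)"

primrec convolution_power :: "('g, 'b) monoid_scheme \<Rightarrow> 'g pmf \<Rightarrow> nat \<Rightarrow> 'g pmf" where
  "convolution_power G \<mu> 0 = return_pmf \<one>\<^bsub>G\<^esub>"
| "convolution_power G \<mu> (Suc n) = convolution G \<mu> (convolution_power G \<mu> n)"

definition translate ::
  "('g \<Rightarrow> 'x \<Rightarrow> 'x) \<Rightarrow> 'x::topological_space measure \<Rightarrow> 'g \<Rightarrow> 'x measure" where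
  "translate act \<nu> s = distr \<nu> borel (act s)"

locale compact_stationary_space =
  measured_group G \<mu> + group_action G "UNIV :: 'x set" act
  for G :: "('g, 'b) monoid_scheme" (structure) and \<mu> :: "'g pmf"
    and act :: "'g \<Rightarrow> 'x::topological_space \<Rightarrow> 'x" +
  fixes \<nu> :: "'x measure"
  assumes compact: "compact (UNIV :: 'x set)"
    and metrizable: "metrizable_space (euclidean :: 'x topology)"
    and homeomorphic: "s \<in> carrier G \<Longrightarrow> homeomorphic_map euclidean euclidean (act s)"
    and borel: "sets \<nu> = sets borel"
    and prob: "prob_space \<nu>"
    and measure_class_preserved: "s \<in> carrier G \<Longrightarrow>
      absolutely_continuous \<nu> (translate act \<nu> s) \<and> absolutely_continuous (translate act \<nu> s) \<nu>"
    and stationary: "continuous_on UNIV (\<phi> :: 'x \<Rightarrow> real) \<Longrightarrow>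
      (\<integral>s. (\<integral>x. \<phi> (act (inv s) x) \<partial>\<nu>) \<partial>measure_pmf \<mu>) = (\<integral>x. \<phi> x \<partial>\<nu>)"

definition minimal_action ::
  "('g, 'b) monoid_scheme \<Rightarrow> ('g \<Rightarrow> 'x::topological_space \<Rightarrow> 'x) \<Rightarrow> bool" where
  "minimal_action G act \<longleftrightarrow> (\<forall>x. closure (orbit G act x) = UNIV)"

definition invariant_measure :: "('g, 'b) monoid_scheme \<Rightarrow> ('g \<Rightarrow> 'x \<Rightarrow> 'x)
    \<Rightarrow> 'x::topological_space measure \<Rightarrow> bool" where
  "invariant_measure G act \<nu> \<longleftrightarrow> (\<forall>s\<in>carrier G. translate act \<nu> s = \<nu>)"

text \<open>
  \<open>RN_deriv\<close> is an arbitrary version of the derivative, determined only up to a null set, so the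
  cocycle is always used through a continuous representative. For a minimal action \<open>\<nu>\<close> has full
  support, hence that representative is unique.
\<close>

definition RN_cocycle :: "('g, 'b) monoid_scheme \<Rightarrow> ('g \<Rightarrow> 'x \<Rightarrow> 'x)
    \<Rightarrow> 'x::topological_space measure \<Rightarrow> 'g \<Rightarrow> 'x \<Rightarrow> real" where
  "RN_cocycle G act \<nu> s x = enn2real (RN_deriv \<nu> (translate act \<nu> (inv\<^bsub>G\<^esub> s)) x)"

definition continuous_representative ::
  "'x::topological_space measure \<Rightarrow> ('x \<Rightarrow> real) \<Rightarrow> ('x \<Rightarrow> real) \<Rightarrow> bool" where
  "continuous_representative \<nu> f h \<longleftrightarrow> continuous_on UNIV h \<and> (AE x in \<nu>. h x = f x)"

end

theory Submission
  imports Defs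
begin

text \<open>
  Put \<open>p = 1 - 2\<epsilon> \<in> (0,1)\<close> and \<open>f\<^sub>n(x) = \<integral> \<sigma>(s,x)\<^sup>p d\<mu>\<^sup>*\<^sup>n(s)\<close>. Stationarity gives
  \<open>\<integral> \<sigma>(s,x) d\<mu>\<^sup>*\<^sup>n(s) \<le> 1\<close> for \<^emph>\<open>every\<close> \<open>x\<close>, because \<open>\<nu>\<close> has full support. As \<open>p < 1\<close>, this bounds
  the tails of the series \<open>f\<^sub>n\<close> uniformly in \<open>x\<close>, so \<open>f\<^sub>n\<close> is continuous. By strict concavity
  \<open>f\<^sub>n \<le> 1\<close>, with \<open>f\<^sub>n(x) = 1\<close> only if \<open>\<sigma>(\<cdot>,x) = 1\<close> on the support of \<open>\<mu>\<^sup>*\<^sup>n\<close>, and the cocycle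
  identity makes \<open>f\<^sub>n\<close> decreasing in \<open>n\<close>. If no \<open>n\<close> works, compactness yields one \<open>x\<close> with
  \<open>f\<^sub>n(x) = 1\<close> for all \<open>n\<close>, whence \<open>\<sigma>(s,x) = 1\<close> for all \<open>s\<close>; the cocycle identity propagates this
  along the dense orbit of \<open>x\<close>, so that \<open>\<sigma> = 1\<close> and \<open>\<nu>\<close> is invariant.
\<close>

section \<open>Elementary inequalities for powers\<close>

text \<open>Strict concavity: the right-hand side is the tangent at 1, touched only there. That
  strictness later yields the equality case \<open>\<sigma> s x = 1\<close>.\<close>

lemma powr_less_tangent_line:
  fixes u p :: real
  assumes u: "0 \<le> u" "u \<noteq> 1" and p: "0 < p" "p < 1"
  shows "u powr p < 1 - p + p * u"
proof (cases "u = 0")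
  case False
  define y where "y = ln u"
  have y: "y \<noteq> 0" "u = exp y" using False u by (auto simp: y_def)
  have strict: "1 + z < exp z" if "z \<noteq> 0" for z :: real
  proof -
    have "1 + z \<noteq> exp z" using that ln_eq_minus_one[of "exp z"] by auto
    then show ?thesis using exp_ge_add_one_self[of z] by linarith
  qed
  \<comment> \<open>The weights \<open>p\<close> and \<open>1 - p\<close> make the linear terms in
    \<open>y\<close> cancel; multiplying by \<open>exp (p * y)\<close> afterwards turns the two
    exponents into \<open>y\<close> and 0.\<close>
  have "1 = p * (1 + (1 - p) * y) + (1 - p) * (1 + - (p * y))" by (simp add: algebra_simps)
  also have "\<dots> < p * exp ((1 - p) * y) + (1 - p) * exp (- (p * y))"
    using p y by (intro add_strict_mono mult_strict_left_mono strict) auto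
  finally have "exp (p * y) * 1 < exp (p * y) * (p * exp ((1 - p) * y) + (1 - p) * exp (- (p * y)))"
    by (intro mult_strict_left_mono) auto
  also have "\<dots> = p * exp (p * y + (1 - p) * y) + (1 - p) * exp (p * y + - (p * y))"
    by (simp only: exp_add) (simp add: algebra_simps)
  finally show ?thesis using y by (simp add: powr_def algebra_simps)
qed (use p in simp)

lemma powr_le_tangent_line:
  fixes u p :: real
  assumes "0 \<le> u" "0 < p" "p < 1"
  shows "u powr p \<le> 1 - p + p * u"
  using powr_less_tangent_line[of u p] assms by (cases "u = 1") auto

text \<open>Sublinear growth with arbitrarily small slope; this gives uniform control of tails in
  \<open>continuous_moment\<close>.\<close>

lemma powr_le_linear_plus_const:
  fixes p \<delta> :: real
  assumes p: "0 < p" "p < 1" and \<delta>: "0 < \<delta>"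
  shows "\<exists>C\<ge>0. \<forall>u\<ge>0. u powr p \<le> \<delta> * u + C"
proof (intro exI conjI allI impI)
  \<comment> \<open>\<open>M\<close> solves \<open>M powr (p - 1) = \<delta>\<close>; beyond it
    \<open>u powr (p - 1)\<close> has dropped below \<open>\<delta>\<close>, before it
    \<open>M powr p\<close> suffices.\<close>
  define M where "M = \<delta> powr (1 / (p - 1))"
  show "0 \<le> M powr p" by simp
  fix u :: real assume u: "0 \<le> u"
  show "u powr p \<le> \<delta> * u + M powr p"
  proof (cases "u \<le> M")
    case True
    then have "u powr p \<le> M powr p" using u p by (intro powr_mono2) auto
    then show ?thesis using u \<delta> by (simp add: add_increasing)
  next
    case False
    have M: "0 < M" "M powr (p - 1) = \<delta>" using \<delta> p by (auto simp: M_def powr_powr)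
    have "u powr p = u powr (p - 1) * u" using False M(1) by (simp add: powr_diff)
    also have "\<dots> \<le> M powr (p - 1) * u"
      using False M(1) p u by (intro mult_right_mono powr_mono2') auto
    finally show ?thesis using M by (simp add: add_increasing2)
  qed
qed

section \<open>Uniform approximation and integration over discrete measures\<close>

lemma continuous_on_uniform_approx:
  fixes f :: "'a::topological_space \<Rightarrow> real"
  assumes "\<And>\<delta>. 0 < \<delta> \<Longrightarrow> \<exists>g. continuous_on S g \<and> (\<forall>x\<in>S. \<bar>f x - g x\<bar> \<le> \<delta>)"
  shows "continuous_on S f"
proof -
  have "\<forall>k. \<exists>g. continuous_on S g \<and> (\<forall>x\<in>S. \<bar>f x - g x\<bar> \<le> inverse (real (Suc k)))"
    using assms by simp
  then obtain g where g: "\<And>k. continuous_on S (g k)"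
    "\<And>k x. x \<in> S \<Longrightarrow> \<bar>f x - g k x\<bar> \<le> inverse (real (Suc k))" by metis
  have "uniform_limit S g f sequentially"
  proof (rule uniform_limitI)
    fix e :: real assume "0 < e"
    have "\<forall>\<^sub>F k in sequentially. inverse (real (Suc k)) < e"
      using LIMSEQ_inverse_real_of_nat \<open>0 < e\<close> by (rule order_tendstoD)
    then show "\<forall>\<^sub>F k in sequentially. \<forall>x\<in>S. dist (g k x) (f x) < e"
    proof eventually_elim
      case (elim k)
      then show ?case using g(2)[of _ k] by (force simp: dist_real_def abs_minus_commute)
    qed
  qed
  then show ?thesis
    by (rule uniform_limit_theorem[rotated]) (auto simp: g(1))
qed

text \<open>The variables are exchanged so that the left factor is integrated first: in
  \<open>\<sigma> (s \<otimes> t) x = \<sigma> s (act t x) * \<sigma> t x\<close> the second factor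
  is then a constant of the inner integral.\<close>

lemma nn_integral_convolution:
  "(\<integral>\<^sup>+ s. f s \<partial>measure_pmf (convolution G \<mu> \<eta>)) =
    (\<integral>\<^sup>+ t. (\<integral>\<^sup>+ s. f (s \<otimes>\<^bsub>G\<^esub> t) \<partial>measure_pmf \<mu>) \<partial>measure_pmf \<eta>)"
  unfolding convolution_def
  by (subst pair_commute_pmf) (simp add: nn_integral_pair_pmf')

lemma set_pmf_convolution:
  "set_pmf (convolution G \<mu> \<eta>) = {s \<otimes>\<^bsub>G\<^esub> t | s t. s \<in> set_pmf \<mu> \<and> t \<in> set_pmf \<eta>}"
  by (auto simp: convolution_def)

lemma finite_exhaustion_set_pmf:
  obtains F :: "nat \<Rightarrow> 'a set" where "incseq F" "\<And>k. finite (F k)" "(\<Union>k. F k) = set_pmf \<eta>"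
proof
  let ?F = "\<lambda>k. {s \<in> set_pmf \<eta>. to_nat_on (set_pmf \<eta>) s < k}"
  show "incseq ?F" by (auto simp: incseq_def)
  show "finite (?F k)" for k
    by (rule finite_imageD[of "to_nat_on (set_pmf \<eta>)"])
      (auto intro!: finite_subset[of _ "{..<k}"] inj_on_subset[OF inj_on_to_nat_on[OF countable_set_pmf]])
  show "(\<Union>k. ?F k) = set_pmf \<eta>" by auto
qed

lemma nn_integral_pmf_indicator_finite:
  assumes F: "finite F" and f: "\<And>s. s \<in> F \<Longrightarrow> 0 \<le> f s"
  shows "(\<integral>\<^sup>+ s. ennreal (f s) * indicator F s \<partial>measure_pmf \<eta>) = ennreal (\<Sum>s\<in>F. pmf \<eta> s * f s)"
proof -
  have "(\<integral>\<^sup>+ s. ennreal (f s) * indicator F s \<partial>measure_pmf \<eta>) =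
      (\<Sum>s\<in>F. ennreal (f s) * indicator F s * pmf \<eta> s)"
    using F by (intro nn_integral_measure_pmf_support) auto
  also have "\<dots> = (\<Sum>s\<in>F. ennreal (pmf \<eta> s * f s))"
    using f by (intro sum.cong) (auto simp: ennreal_mult mult_ac)
  finally show ?thesis using f by (simp add: sum_ennreal)
qed

text \<open>Monotone convergence along a finite exhaustion of the support. It allows stationarity to
  be exploited for finite sums, whose continuity is immediate.\<close>

lemma nn_integral_pmf_leI_finite:
  assumes f: "\<And>s. s \<in> set_pmf \<eta> \<Longrightarrow> 0 \<le> f s"
    and le: "\<And>F. finite F \<Longrightarrow> F \<subseteq> set_pmf \<eta> \<Longrightarrow> (\<Sum>s\<in>F. pmf \<eta> s * f s) \<le> c"
  shows "(\<integral>\<^sup>+ s. ennreal (f s) \<partial>measure_pmf \<eta>) \<le> ennreal c"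
proof -
  obtain F where F: "incseq F" "\<And>k. finite (F k)" "(\<Union>k. F k) = set_pmf \<eta>"
    using finite_exhaustion_set_pmf[of \<eta>] by blast
  have "(\<integral>\<^sup>+ s. ennreal (f s) \<partial>measure_pmf \<eta>) =
      (\<integral>\<^sup>+ s. (SUP k. ennreal (f s) * indicator (F k) s) \<partial>measure_pmf \<eta>)"
  proof (intro nn_integral_cong_AE AE_pmfI)
    fix s assume "s \<in> set_pmf \<eta>"
    then obtain k where "s \<in> F k" using F(3) by auto
    then show "ennreal (f s) = (SUP k. ennreal (f s) * indicator (F k) s)"
      by (intro antisym SUP_upper2[of k] SUP_least) (auto simp: indicator_def)
  qed
  also have "\<dots> = (SUP k. \<integral>\<^sup>+ s. ennreal (f s) * indicator (F k) s \<partial>measure_pmf \<eta>)"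
    using F(1) by (intro nn_integral_monotone_convergence_SUP)
      (auto simp: incseq_def le_fun_def indicator_def)
  also have "\<dots> \<le> ennreal c"
  proof (rule SUP_least)
    fix k
    have "F k \<subseteq> set_pmf \<eta>" using F(3) by auto
    then show "(\<integral>\<^sup>+ s. ennreal (f s) * indicator (F k) s \<partial>measure_pmf \<eta>) \<le> ennreal c"
      using F(2) f le by (subst nn_integral_pmf_indicator_finite) (auto intro!: ennreal_leI)
  qed
  finally show ?thesis .
qed

lemma finite_set_pmf_tail:
  assumes "0 < \<delta>"
  obtains F where "finite F" "F \<subseteq> set_pmf \<eta>" "measure_pmf.prob \<eta> (- F) \<le> \<delta>"
proof -
  obtain F where F: "incseq F" "\<And>k. finite (F k)" "(\<Union>k. F k) = set_pmf \<eta>"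
    using finite_exhaustion_set_pmf[of \<eta>] by blast
  have "(\<lambda>k. measure_pmf.prob \<eta> (F k)) \<longlonglongrightarrow> measure_pmf.prob \<eta> (\<Union>k. F k)"
    using F(1) by (intro measure_pmf.finite_Lim_measure_incseq) auto
  then have "(\<lambda>k. measure_pmf.prob \<eta> (F k)) \<longlonglongrightarrow> 1"
    by (simp add: F(3) measure_pmf.prob_eq_1[THEN iffD2] AE_measure_pmf)
  then have "\<forall>\<^sub>F k in sequentially. 1 - \<delta> < measure_pmf.prob \<eta> (F k)"
    by (rule order_tendstoD) (use assms in simp)
  then obtain k where "1 - \<delta> < measure_pmf.prob \<eta> (F k)"
    by (auto simp: eventually_sequentially)
  then have "measure_pmf.prob \<eta> (- F k) \<le> \<delta>"
    using measure_pmf.prob_compl[of "F k" \<eta>] by (simp add: Compl_eq_Diff_UNIV)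
  with F show ?thesis by (intro that[of "F k"]) auto
qed

section \<open>Supports of convolution powers\<close>

context measured_group
begin

lemma set_pmf_convolution_power_subset: "set_pmf (convolution_power G \<mu> n) \<subseteq> carrier G"
  using support_subset by (induction n) (auto simp: set_pmf_convolution)

lemma set_pmf_convolution_power_mult:
  assumes "s \<in> set_pmf (convolution_power G \<mu> m)" "t \<in> set_pmf (convolution_power G \<mu> n)"
  shows "s \<otimes> t \<in> set_pmf (convolution_power G \<mu> (m + n))"
  using assms(1)
proof (induction m arbitrary: s)
  case 0
  then show ?case using assms(2) set_pmf_convolution_power_subset[of n] by auto
next
  case (Suc m)
  then obtain a b where ab: "s = a \<otimes> b" "a \<in> set_pmf \<mu>" "b \<in> set_pmf (convolution_power G \<mu> m)"
    by (auto simp: set_pmf_convolution)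
  have "s \<otimes> t = a \<otimes> (b \<otimes> t)"
    using ab assms(2) support_subset set_pmf_convolution_power_subset
    by (auto intro!: m_assoc)
  with ab Suc.IH show ?case by (auto simp: set_pmf_convolution)
qed

text \<open>Generation as a semigroup enters here: the union of the supports contains that of
  \<open>\<mu>\<close> and is closed under products. A property known on every support thus holds on
  all of \<open>G\<close>.\<close>

lemma carrier_eq_UN_set_pmf_convolution_power:
  "carrier G = (\<Union>n. set_pmf (convolution_power G \<mu> n))"
proof
  show "carrier G \<subseteq> (\<Union>n. set_pmf (convolution_power G \<mu> n))"
  proof
    fix s assume "s \<in> carrier G"
    then have "s \<in> semigroup_generated G (set_pmf \<mu>)" by (simp add: support_generates)
    then show "s \<in> (\<Union>n. set_pmf (convolution_power G \<mu> n))"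
    proof induction
      case (base s)
      have "s \<in> set_pmf (convolution_power G \<mu> 1)"
        using base support_subset by (force simp: set_pmf_convolution)
      then show ?case by blast
    next
      case (mult s t)
      then show ?case using set_pmf_convolution_power_mult by blast
    qed
  qed
qed (use set_pmf_convolution_power_subset in blast)

end

section \<open>The continuous Radon-Nikodym cocycle\<close>

locale continuous_cocycle_space = compact_stationary_space G \<mu> act \<nu>
  for G :: "('g, 'b) monoid_scheme" (structure) and \<mu> :: "'g pmf"
    and act :: "'g \<Rightarrow> 'x::topological_space \<Rightarrow> 'x" and \<nu> :: "'x measure" +
  fixes \<sigma> :: "'g \<Rightarrow> 'x \<Rightarrow> real"
  assumes minimal: "minimal_action G act"
    and representative:
      "s \<in> carrier G \<Longrightarrow> continuous_representative \<nu> (RN_cocycle G act \<nu> s) (\<sigma> s)"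
begin

sublocale prob_space \<nu> by (rule prob)

lemma space_eq_UNIV [simp]: "space \<nu> = UNIV"
  using sets_eq_imp_space_eq[OF borel] by simp

lemma continuous_act: "s \<in> carrier G \<Longrightarrow> continuous_on UNIV (act s)"
  using homeomorphic_imp_continuous_map[OF homeomorphic] by simp

lemma borel_measurable_eq: "borel_measurable \<nu> = borel_measurable borel"
  by (rule measurable_cong_sets) (auto simp: borel)

lemma measurable_act [measurable]: "s \<in> carrier G \<Longrightarrow> act s \<in> borel_measurable borel"
  by (intro borel_measurable_continuous_onI continuous_act)

lemma act_mult: "s \<in> carrier G \<Longrightarrow> t \<in> carrier G \<Longrightarrow> act (s \<otimes> t) x = act s (act t x)"
  using composition_rule[of x s t] by simp

lemma act_one: "act \<one> x = x"
  using fun_cong[OF id_eq_one, of x] by simp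

lemma act_act_inv: "s \<in> carrier G \<Longrightarrow> act s (act (inv s) x) = x"
  using act_mult[of s "inv s" x] by (simp add: act_one)

lemma continuous_sigma: "s \<in> carrier G \<Longrightarrow> continuous_on UNIV (\<sigma> s)"
  using representative by (auto simp: continuous_representative_def)

lemma measurable_sigma [measurable]: "s \<in> carrier G \<Longrightarrow> \<sigma> s \<in> borel_measurable borel"
  by (intro borel_measurable_continuous_onI continuous_sigma)

lemma translate_inv_eq_density:
  assumes s: "s \<in> carrier G"
  shows "translate act \<nu> (inv s) = density \<nu> (\<lambda>x. ennreal (\<sigma> s x))"
proof -
  let ?N = "translate act \<nu> (inv s)"
  interpret N: prob_space ?N
    unfolding translate_def using s by (intro prob_space_distr) (simp add: borel_measurable_eq)
  have ac: "absolutely_continuous \<nu> ?N" and sets: "sets ?N = sets \<nu>"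
    using measure_class_preserved[of "inv s"] s by (auto simp: translate_def borel)
  \<comment> \<open>\<open>enn2real\<close> sends infinity to 0; as the translate is a probability
    measure, the derivative is finite almost everywhere and nothing is lost.\<close>
  have "AE x in \<nu>. RN_deriv \<nu> ?N x \<noteq> \<infinity>"
    by (rule RN_deriv_finite[OF _ ac sets]) unfold_locales
  moreover have "AE x in \<nu>. \<sigma> s x = enn2real (RN_deriv \<nu> ?N x)"
    using representative[OF s] by (simp add: continuous_representative_def RN_cocycle_def)
  ultimately have "AE x in \<nu>. RN_deriv \<nu> ?N x = ennreal (\<sigma> s x)"
    by eventually_elim (simp add: less_top)
  then have "density \<nu> (RN_deriv \<nu> ?N) = density \<nu> (\<lambda>x. ennreal (\<sigma> s x))"
    using s by (intro density_cong borel_measurable_RN_deriv) (auto simp: borel_measurable_eq)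
  then show ?thesis
    using density_RN_deriv[OF ac sets] by simp
qed

lemma nn_integral_act_inv:
  assumes s: "s \<in> carrier G" and [measurable]: "f \<in> borel_measurable borel"
  shows "(\<integral>\<^sup>+ x. f (act (inv s) x) \<partial>\<nu>) = (\<integral>\<^sup>+ x. ennreal (\<sigma> s x) * f x \<partial>\<nu>)"
proof -
  have "(\<integral>\<^sup>+ x. f (act (inv s) x) \<partial>\<nu>) = (\<integral>\<^sup>+ x. f x \<partial>translate act \<nu> (inv s))"
    unfolding translate_def using s by (subst nn_integral_distr) (auto simp: borel_measurable_eq)
  also have "\<dots> = (\<integral>\<^sup>+ x. ennreal (\<sigma> s x) * f x \<partial>\<nu>)"
    unfolding translate_inv_eq_density[OF s] using s
    by (subst nn_integral_density) (auto simp: borel_measurable_eq)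
  finally show ?thesis .
qed

section \<open>Full support and pointwise identities\<close>

text \<open>By minimality every orbit meets a nonempty open \<open>U\<close>, so the countably many
  preimages of \<open>U\<close> cover the space. They are null with \<open>U\<close> because the
  measure class is preserved.\<close>

lemma open_null_set_empty:
  assumes U: "open U" "emeasure \<nu> U = 0"
  shows "U = {}"
proof (rule ccontr)
  assume "U \<noteq> {}"
  have "act s -` U \<in> null_sets \<nu>" if s: "s \<in> carrier G" for s
  proof -
    have "U \<in> null_sets \<nu>" using U borel by auto
    then have "U \<in> null_sets (translate act \<nu> s)"
      using measure_class_preserved[OF s] by (auto simp: absolutely_continuous_def)
    then have "emeasure \<nu> (act s -` U) = 0"
      using s U(1) by (auto simp: translate_def null_sets_def emeasure_distr borel_measurable_eq)
    moreover have "act s -` U \<in> sets \<nu>"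
      unfolding borel using continuous_act[OF s] U(1) by (auto intro!: borel_open open_vimage)
    ultimately show ?thesis by auto
  qed
  then have "(\<Union>s\<in>carrier G. act s -` U) \<in> null_sets \<nu>"
    by (rule null_sets_UN'[OF countable_carrier])
  moreover have "(\<Union>s\<in>carrier G. act s -` U) = UNIV"
  proof -
    have "\<exists>s\<in>carrier G. act s x \<in> U" for x
    proof -
      have "closure (orbit G act x) = UNIV" using minimal by (simp add: minimal_action_def)
      then have "U \<inter> orbit G act x \<noteq> {}"
        using open_Int_closure_eq_empty[OF U(1), of "orbit G act x"] \<open>U \<noteq> {}\<close> by auto
      then show ?thesis by (auto simp: orbit_def)
    qed
    then show ?thesis by auto
  qed
  ultimately show False using emeasure_space_1 by auto
qed

text \<open>The exceptional set is open and null, hence empty. This is how facts about derivatives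
  become statements about every \<open>x\<close>.\<close>

lemma AE_imp_everywhere:
  assumes "closed {x. P x}" "AE x in \<nu>. P x"
  shows "P x"
proof -
  have op: "open {x. \<not> P x}" using assms(1) by (simp add: closed_def Collect_neg_eq)
  then have "{x. \<not> P x} \<in> sets \<nu>" by (simp add: borel)
  then have "emeasure \<nu> {x. \<not> P x} = 0"
    using assms(2) AE_iff_measurable[of "{x. \<not> P x}" \<nu> P] by simp
  with op have "{x. \<not> P x} = {}" by (rule open_null_set_empty)
  then show ?thesis by auto
qed

lemma sigma_nonneg: "s \<in> carrier G \<Longrightarrow> 0 \<le> \<sigma> s x"
proof (rule AE_imp_everywhere[where P = "\<lambda>x. 0 \<le> \<sigma> s x"])
  assume s: "s \<in> carrier G"
  show "closed {x. 0 \<le> \<sigma> s x}"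
    by (intro closed_Collect_le continuous_intros continuous_sigma s)
  show "AE x in \<nu>. 0 \<le> \<sigma> s x"
    using representative[OF s] by (auto simp: continuous_representative_def RN_cocycle_def)
qed

lemma continuous_eqI_density:
  fixes f g :: "'x \<Rightarrow> real"
  assumes f: "continuous_on UNIV f" "\<And>x. 0 \<le> f x" and g: "continuous_on UNIV g" "\<And>x. 0 \<le> g x"
    and eq: "density \<nu> (\<lambda>x. ennreal (f x)) = density \<nu> (\<lambda>x. ennreal (g x))"
  shows "f x = g x"
proof (rule AE_imp_everywhere[where P = "\<lambda>x. f x = g x"])
  show "closed {x. f x = g x}"
    using f g by (intro closed_Collect_eq)
  have [measurable]: "f \<in> borel_measurable borel" "g \<in> borel_measurable borel"
    using f g by (auto intro: borel_measurable_continuous_onI)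
  have "AE x in \<nu>. ennreal (f x) = ennreal (g x)"
    using eq by (subst (asm) density_unique_iff) (auto simp: borel_measurable_eq)
  then show "AE x in \<nu>. f x = g x"
    by eventually_elim (use f g in simp)
qed

text \<open>Chain rule: both sides are continuous densities of the translate of \<open>\<nu>\<close>
  by \<open>inv (s \<otimes> t)\<close>, as two successive changes of variables show, so they agree
  everywhere.\<close>

lemma sigma_cocycle:
  assumes s: "s \<in> carrier G" and t: "t \<in> carrier G"
  shows "\<sigma> (s \<otimes> t) x = \<sigma> s (act t x) * \<sigma> t x"
proof (rule continuous_eqI_density)
  show "continuous_on UNIV (\<lambda>x. \<sigma> s (act t x) * \<sigma> t x)"
    using continuous_on_compose2[OF continuous_sigma[OF s] continuous_act[OF t]]
    by (intro continuous_intros continuous_sigma t) auto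
  show "density \<nu> (\<lambda>x. ennreal (\<sigma> (s \<otimes> t) x)) = density \<nu> (\<lambda>x. ennreal (\<sigma> s (act t x) * \<sigma> t x))"
  proof (rule measure_eqI)
    fix A assume "A \<in> sets (density \<nu> (\<lambda>x. ennreal (\<sigma> (s \<otimes> t) x)))"
    then have [measurable]: "A \<in> sets borel" by (simp add: borel)
    note [measurable] = measurable_act[OF t] measurable_act[OF inv_closed[OF t]]
      measurable_sigma[OF s] measurable_sigma[OF t] measurable_sigma[OF m_closed[OF s t]]
    have "emeasure (density \<nu> (\<lambda>x. ennreal (\<sigma> (s \<otimes> t) x))) A
        = (\<integral>\<^sup>+ x. ennreal (\<sigma> (s \<otimes> t) x) * indicator A x \<partial>\<nu>)"
      by (rule emeasure_density) (auto simp: borel_measurable_eq borel)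
    also have "\<dots> = (\<integral>\<^sup>+ x. indicator A (act (inv (s \<otimes> t)) x) \<partial>\<nu>)"
      using s t by (subst nn_integral_act_inv) auto
    also have "\<dots> = (\<integral>\<^sup>+ x. indicator A (act (inv t) (act (inv s) x)) \<partial>\<nu>)"
      using s t by (simp add: inv_mult_group act_mult)
    also have "\<dots> = (\<integral>\<^sup>+ x. ennreal (\<sigma> s x) * indicator A (act (inv t) x) \<partial>\<nu>)"
      by (rule nn_integral_act_inv[OF s]) measurable
    \<comment> \<open>Writing \<open>x\<close> as \<open>act t (act (inv t) x)\<close> makes the
      whole integrand a function of \<open>act (inv t) x\<close>, ready for the second change of
      variables.\<close>
    also have "\<dots> = (\<integral>\<^sup>+ x. (\<lambda>y. ennreal (\<sigma> s (act t y)) * indicator A y) (act (inv t) x) \<partial>\<nu>)"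
      by (simp add: act_act_inv t)
    also have "\<dots> = (\<integral>\<^sup>+ x. ennreal (\<sigma> t x) * (ennreal (\<sigma> s (act t x)) * indicator A x) \<partial>\<nu>)"
      by (rule nn_integral_act_inv[OF t]) measurable
    also have "\<dots> = (\<integral>\<^sup>+ x. ennreal (\<sigma> s (act t x) * \<sigma> t x) * indicator A x \<partial>\<nu>)"
      by (simp add: ennreal_mult sigma_nonneg s t mult_ac)
    also have "\<dots> = emeasure (density \<nu> (\<lambda>x. ennreal (\<sigma> s (act t x) * \<sigma> t x))) A"
      by (rule emeasure_density[symmetric]) (auto simp: borel_measurable_eq borel)
    finally show "emeasure (density \<nu> (\<lambda>x. ennreal (\<sigma> (s \<otimes> t) x))) A
        = emeasure (density \<nu> (\<lambda>x. ennreal (\<sigma> s (act t x) * \<sigma> t x))) A" .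
  qed simp
qed (use s t in \<open>auto intro!: continuous_sigma sigma_nonneg mult_nonneg_nonneg\<close>)

lemma sigma_one: "\<sigma> \<one> x = 1"
proof (rule continuous_eqI_density)
  have "translate act \<nu> \<one> = distr \<nu> \<nu> (\<lambda>x. x)"
    unfolding translate_def by (intro distr_cong) (auto simp: borel act_one)
  then show "density \<nu> (\<lambda>x. ennreal (\<sigma> \<one> x)) = density \<nu> (\<lambda>x. ennreal 1)"
    using translate_inv_eq_density[OF one_closed] by (simp add: distr_id density_1)
qed (auto intro!: continuous_sigma sigma_nonneg)

section \<open>Consequences of stationarity\<close>

text \<open>
  For the sum \<open>g\<close> below, the test function \<open>(g - 1)\<^sup>+\<close> turns stationarity into \<open>\<integral> ((g - 1)\<^sup>+)\<^sup>2 d\<nu> \<le> 0\<close>.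
\<close>

lemma finite_sum_sigma_le_1:
  assumes F: "finite F" "F \<subseteq> carrier G"
  shows "(\<Sum>s\<in>F. pmf \<mu> s * \<sigma> s x) \<le> 1"
proof -
  define g where "g x = (\<Sum>s\<in>F. pmf \<mu> s * \<sigma> s x)" for x
  define \<phi> where "\<phi> x = max 0 (g x - 1)" for x
  have cont_g: "continuous_on UNIV g"
    unfolding g_def using F by (intro continuous_intros continuous_sigma) auto
  then have cont: "continuous_on UNIV \<phi>"
    unfolding \<phi>_def by (intro continuous_intros)
  have [measurable]: "\<phi> \<in> borel_measurable borel" "g \<in> borel_measurable borel"
    using cont cont_g by (auto intro: borel_measurable_continuous_onI)
  have "bounded (\<phi> ` UNIV)" using cont compact by (intro compact_imp_bounded compact_continuous_image)
  then obtain B where B: "\<And>x. \<bar>\<phi> x\<bar> \<le> B" by (auto simp: bounded_iff)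
  have int: "integrable \<nu> h" if "continuous_on UNIV h" for h :: "'x \<Rightarrow> real"
  proof -
    have "bounded (h ` UNIV)"
      using that compact by (intro compact_imp_bounded compact_continuous_image)
    then obtain B where "\<And>x. \<bar>h x\<bar> \<le> B" by (auto simp: bounded_iff)
    then show ?thesis
      using that by (intro integrable_const_bound[where B = B])
        (auto simp: borel_measurable_eq intro: borel_measurable_continuous_onI)
  qed
  have change: "(\<integral>x. \<phi> (act (inv s) x) \<partial>\<nu>) = (\<integral>x. \<sigma> s x * \<phi> x \<partial>\<nu>)" if s: "s \<in> carrier G" for s
  proof -
    have "(\<integral>\<^sup>+ x. ennreal (\<phi> (act (inv s) x)) \<partial>\<nu>) = (\<integral>\<^sup>+ x. ennreal (\<sigma> s x) * ennreal (\<phi> x) \<partial>\<nu>)"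
      by (rule nn_integral_act_inv[OF s]) measurable
    also have "\<dots> = (\<integral>\<^sup>+ x. ennreal (\<sigma> s x * \<phi> x) \<partial>\<nu>)"
      by (simp add: ennreal_mult sigma_nonneg s \<phi>_def)
    finally show ?thesis
      using s by (subst (1 2) integral_eq_nn_integral)
        (auto simp: borel_measurable_eq \<phi>_def sigma_nonneg)
  qed
  define I where "I s = (\<integral>x. \<phi> (act (inv s) x) \<partial>\<nu>)" for s
  have I_nonneg: "0 \<le> I s" for s by (auto simp: I_def \<phi>_def intro!: integral_nonneg_AE)
  \<comment> \<open>For \<open>s\<close> outside \<open>carrier G\<close> integrability is not
    guaranteed; a non-integrable function has integral 0 by convention, so the bound still
    holds.\<close>
  have I_bound: "\<bar>I s\<bar> \<le> \<bar>B\<bar>" for s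
  proof (cases "integrable \<nu> (\<lambda>x. \<phi> (act (inv s) x))")
    case True
    have "\<bar>I s\<bar> \<le> (\<integral>x. \<bar>\<phi> (act (inv s) x)\<bar> \<partial>\<nu>)" unfolding I_def by (rule integral_abs_bound)
    also have "\<dots> \<le> (\<integral>x. \<bar>B\<bar> \<partial>\<nu>)"
      using True B by (intro integral_mono) (auto intro: order.trans[OF _ abs_ge_self])
    finally show ?thesis using prob_space by simp
  qed (simp add: I_def not_integrable_integral_eq)
  have I_int: "integrable (measure_pmf \<mu>) I"
    by (rule measure_pmf.integrable_const_bound[where B = "\<bar>B\<bar>"]) (auto simp: I_bound)
  have "(\<integral>x. g x * \<phi> x \<partial>\<nu>) = (\<Sum>s\<in>F. pmf \<mu> s * (\<integral>x. \<sigma> s x * \<phi> x \<partial>\<nu>))"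
  proof -
    have "(\<integral>x. g x * \<phi> x \<partial>\<nu>) = (\<integral>x. (\<Sum>s\<in>F. pmf \<mu> s * (\<sigma> s x * \<phi> x)) \<partial>\<nu>)"
      by (simp add: g_def sum_distrib_right mult.assoc)
    also have "\<dots> = (\<Sum>s\<in>F. (\<integral>x. pmf \<mu> s * (\<sigma> s x * \<phi> x) \<partial>\<nu>))"
      using F cont by (intro Bochner_Integration.integral_sum int continuous_intros continuous_sigma) auto
    finally show ?thesis by simp
  qed
  also have "\<dots> = (\<Sum>s\<in>F. pmf \<mu> s * I s)"
    using F change by (intro sum.cong) (auto simp: I_def)
  also have "\<dots> = (\<integral>s. I s * indicator F s \<partial>measure_pmf \<mu>)"
    using F by (subst integral_measure_pmf_real[where A = F]) (auto simp: mult_ac indicator_def)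
  \<comment> \<open>Terms outside \<open>F\<close> may be added because \<open>\<phi>\<close> is
    nonnegative.\<close>
  also have "\<dots> \<le> (\<integral>s. I s \<partial>measure_pmf \<mu>)"
    using I_nonneg I_int by (intro integral_mono integrable_real_mult_indicator) (auto simp: indicator_def)
  also have "\<dots> = (\<integral>x. \<phi> x \<partial>\<nu>)"
    unfolding I_def by (rule stationary[OF cont])
  finally have "(\<integral>x. (g x - 1) * \<phi> x \<partial>\<nu>) \<le> 0"
    using cont cont_g
    by (simp add: left_diff_distrib int continuous_intros)
  moreover have sq: "(g x - 1) * \<phi> x = \<phi> x ^ 2" for x
    by (auto simp: \<phi>_def max_def power2_eq_square)
  ultimately have "(\<integral>x. \<phi> x ^ 2 \<partial>\<nu>) = 0"
    by (simp add: order.antisym)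
  then have "AE x in \<nu>. \<phi> x ^ 2 = 0"
    using cont by (subst (asm) integral_nonneg_eq_0_iff_AE) (auto intro!: int continuous_intros)
  then have "AE x in \<nu>. g x \<le> 1"
    by eventually_elim (auto simp: \<phi>_def max_def split: if_splits)
  then have "g x \<le> 1"
    by (rule AE_imp_everywhere[rotated]) (intro closed_Collect_le cont_g continuous_intros)
  then show ?thesis by (simp add: g_def)
qed

lemma nn_integral_sigma_le_1: "(\<integral>\<^sup>+ s. ennreal (\<sigma> s x) \<partial>measure_pmf \<mu>) \<le> 1"
  using support_subset nn_integral_pmf_leI_finite[of \<mu> "\<lambda>s. \<sigma> s x" 1]
  by (auto intro!: sigma_nonneg finite_sum_sigma_le_1)

text \<open>The cocycle identity factors the integrand. Exponent 1 serves the mass bound that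
  follows, exponents below 1 the monotonicity of the moments.\<close>

lemma nn_integral_convolution_power_Suc:
  assumes "0 \<le> p"
  shows "(\<integral>\<^sup>+ s. ennreal (\<sigma> s x powr p) \<partial>measure_pmf (convolution_power G \<mu> (Suc n))) =
    (\<integral>\<^sup>+ t. ennreal (\<sigma> t x powr p) * (\<integral>\<^sup>+ s. ennreal (\<sigma> s (act t x) powr p) \<partial>measure_pmf \<mu>)
      \<partial>measure_pmf (convolution_power G \<mu> n))"
proof -
  have "(\<integral>\<^sup>+ s. ennreal (\<sigma> (s \<otimes> t) x powr p) \<partial>measure_pmf \<mu>) =
      ennreal (\<sigma> t x powr p) * (\<integral>\<^sup>+ s. ennreal (\<sigma> s (act t x) powr p) \<partial>measure_pmf \<mu>)"
    if "t \<in> set_pmf (convolution_power G \<mu> n)" for t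
  proof -
    have t: "t \<in> carrier G" using that set_pmf_convolution_power_subset by auto
    have "(\<integral>\<^sup>+ s. ennreal (\<sigma> (s \<otimes> t) x powr p) \<partial>measure_pmf \<mu>) =
      (\<integral>\<^sup>+ s. ennreal (\<sigma> t x powr p) * ennreal (\<sigma> s (act t x) powr p) \<partial>measure_pmf \<mu>)"
      using t support_subset
      by (intro nn_integral_cong_AE)
        (auto simp: AE_measure_pmf_iff sigma_cocycle powr_mult sigma_nonneg ennreal_mult mult_ac)
    then show ?thesis by (simp add: nn_integral_cmult)
  qed
  then show ?thesis
    by (auto simp: nn_integral_convolution AE_measure_pmf_iff intro!: nn_integral_cong_AE)
qed

lemma nn_integral_convolution_power_le_1:
  "(\<integral>\<^sup>+ s. ennreal (\<sigma> s x) \<partial>measure_pmf (convolution_power G \<mu> n)) \<le> 1"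
proof -
  \<comment> \<open>Since \<sigma> is nonnegative on the support, exponent 1 changes nothing, and
    the recursion for powers applies.\<close>
  have eq: "(\<integral>\<^sup>+ s. ennreal (\<sigma> s y) \<partial>measure_pmf \<eta>) = (\<integral>\<^sup>+ s. ennreal (\<sigma> s y powr 1) \<partial>measure_pmf \<eta>)"
    if "set_pmf \<eta> \<subseteq> carrier G" for \<eta> y
    using that by (intro nn_integral_cong_AE) (auto simp: AE_measure_pmf_iff sigma_nonneg)
  have "(\<integral>\<^sup>+ s. ennreal (\<sigma> s x powr 1) \<partial>measure_pmf (convolution_power G \<mu> n)) \<le> 1"
  proof (induction n)
    case 0
    then show ?case by (simp add: sigma_one)
  next
    case (Suc n)
    have "(\<integral>\<^sup>+ s. ennreal (\<sigma> s x powr 1) \<partial>measure_pmf (convolution_power G \<mu> (Suc n)))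
      \<le> (\<integral>\<^sup>+ t. ennreal (\<sigma> t x powr 1) * 1 \<partial>measure_pmf (convolution_power G \<mu> n))"
      using nn_integral_sigma_le_1 unfolding eq[OF support_subset]
      by (subst nn_integral_convolution_power_Suc) (auto intro!: nn_integral_mono mult_left_mono
        simp del: mult_1_right powr_one')
    with Suc show ?case by (auto intro: order.trans)
  qed
  then show ?thesis using eq[OF set_pmf_convolution_power_subset] by simp
qed

section \<open>Moments of the cocycle\<close>

text \<open>This is \<open>f\<^sub>n\<close> of the overview, with extended nonnegative values so
  that no integrability question arises.\<close>

definition moment :: "real \<Rightarrow> nat \<Rightarrow> 'x \<Rightarrow> ennreal" where
  "moment p n x = (\<integral>\<^sup>+ s. ennreal (\<sigma> s x powr p) \<partial>measure_pmf (convolution_power G \<mu> n))"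

text \<open>The gap below the tangent line is kept as a separate integral: together with the moment
  it adds up to \<open>1 - p\<close> plus \<open>p\<close> times the integral of \<sigma>, and the
  equality case can be read off.\<close>

lemma moment_plus_defect_le_1:
  assumes p: "0 < p" "p < 1"
  shows "moment p n x + (\<integral>\<^sup>+ s. ennreal (1 - p + p * \<sigma> s x - \<sigma> s x powr p)
    \<partial>measure_pmf (convolution_power G \<mu> n)) \<le> 1"
proof -
  let ?M = "measure_pmf (convolution_power G \<mu> n)"
  have nn: "AE s in ?M. 0 \<le> \<sigma> s x"
    using set_pmf_convolution_power_subset[of n] by (auto simp: AE_measure_pmf_iff intro!: sigma_nonneg)
  have "moment p n x + (\<integral>\<^sup>+ s. ennreal (1 - p + p * \<sigma> s x - \<sigma> s x powr p) \<partial>?M)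
      = (\<integral>\<^sup>+ s. ennreal (\<sigma> s x powr p) + ennreal (1 - p + p * \<sigma> s x - \<sigma> s x powr p) \<partial>?M)"
    unfolding moment_def by (rule nn_integral_add[symmetric]) auto
  also have "\<dots> = (\<integral>\<^sup>+ s. ennreal (1 - p) + ennreal p * ennreal (\<sigma> s x) \<partial>?M)"
  proof (rule nn_integral_cong_AE, use nn in eventually_elim)
    case (elim s)
    with p powr_le_tangent_line[OF elim p] show ?case
      by (simp add: ennreal_plus[symmetric] ennreal_mult[symmetric] del: ennreal_plus)
  qed
  also have "\<dots> = ennreal (1 - p) + ennreal p * (\<integral>\<^sup>+ s. ennreal (\<sigma> s x) \<partial>?M)"
    by (simp add: nn_integral_add nn_integral_cmult measure_pmf.emeasure_space_1[simplified])
  also have "\<dots> \<le> ennreal (1 - p) + ennreal p * 1"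
    by (intro add_left_mono mult_left_mono nn_integral_convolution_power_le_1) simp
  also have "\<dots> = 1" using p by (simp flip: ennreal_plus)
  finally show ?thesis .
qed

lemma moment_le_1: "0 < p \<Longrightarrow> p < 1 \<Longrightarrow> moment p n x \<le> 1"
  by (rule order.trans[OF add_increasing2 moment_plus_defect_le_1]) auto

text \<open>A moment of 1 leaves no room for the defect, which then vanishes at each atom;
  strictness of the tangent inequality excludes any value other than 1.\<close>

lemma sigma_eq_1_if_moment_ge_1:
  assumes p: "0 < p" "p < 1" and "1 \<le> moment p n x"
    and s: "s \<in> set_pmf (convolution_power G \<mu> n)"
  shows "\<sigma> s x = 1"
proof -
  let ?M = "measure_pmf (convolution_power G \<mu> n)"
  let ?D = "\<lambda>s. 1 - p + p * \<sigma> s x - \<sigma> s x powr p"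
  have "moment p n x = 1" using assms moment_le_1 by (simp add: order.antisym)
  then have "(\<integral>\<^sup>+ s. ennreal (?D s) \<partial>?M) = 0"
    using moment_plus_defect_le_1[OF p, of n x] by (simp add: ennreal_add_left_cancel_le[of 1 _ 0, simplified])
  then have "AE s in ?M. ennreal (?D s) = 0"
    by (subst (asm) nn_integral_0_iff_AE) auto
  then have "?D s \<le> 0" using s by (auto simp: AE_measure_pmf_iff ennreal_eq_0_iff)
  moreover have "0 \<le> \<sigma> s x" using s set_pmf_convolution_power_subset[of n] by (auto intro: sigma_nonneg)
  ultimately show ?thesis
    using powr_less_tangent_line[of "\<sigma> s x" p] p by force
qed

text \<open>The inner integral of the recursion is the first moment at \<open>act t x\<close>, hence
  at most 1.\<close>

lemma moment_Suc_le:
  assumes p: "0 < p" "p < 1"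
  shows "moment p (Suc n) x \<le> moment p n x"
proof -
  have one: "(\<integral>\<^sup>+ s. ennreal (\<sigma> s y powr p) \<partial>measure_pmf \<mu>) \<le> 1" for y
  proof -
    have "moment p (Suc 0) y = (\<integral>\<^sup>+ s. ennreal (\<sigma> s y powr p) \<partial>measure_pmf \<mu>)"
      unfolding moment_def using p
      by (subst nn_integral_convolution_power_Suc) (auto simp: sigma_one act_one)
    then show ?thesis using moment_le_1[OF p, of "Suc 0" y] by simp
  qed
  have "moment p (Suc n) x \<le>
      (\<integral>\<^sup>+ t. ennreal (\<sigma> t x powr p) * 1 \<partial>measure_pmf (convolution_power G \<mu> n))"
    unfolding moment_def using p one
    by (subst nn_integral_convolution_power_Suc)
      (auto intro!: nn_integral_mono mult_left_mono simp del: mult_1_right)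
  then show ?thesis by (simp add: moment_def)
qed

text \<open>
  Splitting off a finite set \<open>F\<close> of large measure, the inequality \<open>u\<^sup>p \<le> \<delta>u + C\<close> bounds the remaining
  part of the moment by \<open>\<delta> + C \<mu>\<^sup>*\<^sup>n(G - F)\<close>, uniformly in \<open>x\<close>.
\<close>

lemma continuous_moment:
  assumes p: "0 < p" "p < 1"
  shows "continuous_on UNIV (\<lambda>x. enn2real (moment p n x))"
proof (rule continuous_on_uniform_approx)
  fix \<delta> :: real assume \<delta>: "0 < \<delta>"
  let ?\<eta> = "convolution_power G \<mu> n"
  obtain C where C: "0 \<le> C" "\<And>u. 0 \<le> u \<Longrightarrow> u powr p \<le> \<delta>/2 * u + C"
    using powr_le_linear_plus_const[of p "\<delta>/2"] p \<delta> by auto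
  \<comment> \<open>The slope \<open>\<delta>/2\<close> costs at most \<open>\<delta>/2\<close>, as
    \<sigma> has integral at most 1; this tail keeps the constant's share below
    \<open>\<delta>/2\<close>, with \<open>C + 1\<close> avoiding division by 0.\<close>
  obtain F where F: "finite F" "F \<subseteq> set_pmf ?\<eta>" "measure_pmf.prob ?\<eta> (- F) \<le> \<delta> / (2 * (C + 1))"
    using finite_set_pmf_tail[of "\<delta> / (2 * (C + 1))" ?\<eta>] \<delta> C(1) by auto
  have Fc: "F \<subseteq> carrier G" using F set_pmf_convolution_power_subset by auto
  have nn: "AE s in measure_pmf ?\<eta>. 0 \<le> \<sigma> s x" for x
    using set_pmf_convolution_power_subset[of n] by (auto simp: AE_measure_pmf_iff intro!: sigma_nonneg)
  define g where "g x = (\<Sum>s\<in>F. pmf ?\<eta> s * \<sigma> s x powr p)" for x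
  have "continuous_on UNIV g"
    unfolding g_def using Fc p
    by (intro continuous_intros continuous_on_powr' continuous_sigma) (auto simp: sigma_nonneg)
  moreover have "\<bar>enn2real (moment p n x) - g x\<bar> \<le> \<delta>" for x
  proof -
    let ?T = "\<integral>\<^sup>+ s. ennreal (\<sigma> s x powr p) * indicator (- F) s \<partial>measure_pmf ?\<eta>"
    have g_nonneg: "0 \<le> g x" by (auto simp: g_def intro!: sum_nonneg)
    have "moment p n x = (\<integral>\<^sup>+ s. ennreal (\<sigma> s x powr p) * indicator F s
        + ennreal (\<sigma> s x powr p) * indicator (- F) s \<partial>measure_pmf ?\<eta>)"
      unfolding moment_def by (intro nn_integral_cong) (auto simp: indicator_def)
    also have "\<dots> = (\<integral>\<^sup>+ s. ennreal (\<sigma> s x powr p) * indicator F s \<partial>measure_pmf ?\<eta>) + ?T"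
      by (rule nn_integral_add) auto
    also have "(\<integral>\<^sup>+ s. ennreal (\<sigma> s x powr p) * indicator F s \<partial>measure_pmf ?\<eta>) = ennreal (g x)"
      unfolding g_def using F(1) by (rule nn_integral_pmf_indicator_finite) simp
    finally have split: "moment p n x = ennreal (g x) + ?T" .
    have "?T \<le> (\<integral>\<^sup>+ s. ennreal (\<delta>/2) * ennreal (\<sigma> s x) + ennreal C * indicator (- F) s
        \<partial>measure_pmf ?\<eta>)"
    proof (rule nn_integral_mono_AE, use nn[of x] in eventually_elim)
      case (elim s)
      then show ?case
        using C(2)[OF elim] C(1) \<delta>
        by (auto simp: indicator_def ennreal_mult[symmetric] ennreal_plus[symmetric] simp del: ennreal_plus
            intro!: ennreal_leI)
    qed
    also have "\<dots> = ennreal (\<delta>/2) * (\<integral>\<^sup>+ s. ennreal (\<sigma> s x) \<partial>measure_pmf ?\<eta>)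
        + ennreal C * emeasure (measure_pmf ?\<eta>) (- F)"
      by (simp add: nn_integral_add nn_integral_cmult nn_integral_cmult_indicator)
    also have "\<dots> \<le> ennreal (\<delta>/2) * 1 + ennreal C * ennreal (\<delta> / (2 * (C + 1)))"
      using F(3) by (intro add_mono mult_left_mono nn_integral_convolution_power_le_1)
        (auto simp: measure_pmf.emeasure_eq_measure intro!: ennreal_leI)
    also have "\<dots> = ennreal (\<delta>/2 + C * (\<delta> / (2 * (C + 1))))"
      using \<delta> C by (simp add: ennreal_mult[symmetric] ennreal_plus[symmetric] del: ennreal_plus)
    also have "\<dots> \<le> ennreal \<delta>"
      using \<delta> C by (intro ennreal_leI) (simp add: field_simps)
    finally have T: "?T \<le> ennreal \<delta>" .
    then have "?T < \<infinity>" by (rule le_less_trans) (simp add: less_top[symmetric])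
    have "enn2real ?T \<le> \<delta>" using T \<delta> by (simp add: enn2real_leI)
    moreover have "enn2real (moment p n x) = g x + enn2real ?T"
      unfolding split using g_nonneg \<open>?T < \<infinity>\<close> by (simp add: enn2real_plus)
    ultimately show ?thesis by simp
  qed
  ultimately show "\<exists>g. continuous_on UNIV g \<and> (\<forall>x\<in>UNIV. \<bar>enn2real (moment p n x) - g x\<bar> \<le> \<delta>)"
    by blast
qed

section \<open>Compactness and conclusion\<close>

lemma invariant_if_sigma_eq_1:
  assumes x: "\<And>s. s \<in> carrier G \<Longrightarrow> \<sigma> s x = 1"
  shows "invariant_measure G act \<nu>"
  unfolding invariant_measure_def
proof
  fix s assume s: "s \<in> carrier G"
  have "closed {y. \<sigma> (inv s) y = 1}"
    using s by (intro closed_Collect_eq continuous_sigma continuous_intros) auto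
  \<comment> \<open>In the cocycle identity for \<open>inv s\<close> and \<open>t\<close> at
    \<open>x\<close>, both \<open>\<sigma> (inv s \<otimes> t) x\<close> and
    \<open>\<sigma> t x\<close> are 1. The inverse appears because \<open>\<sigma> (inv s)\<close>
    is the density of the translate by \<open>s\<close>.\<close>
  moreover have "orbit G act x \<subseteq> {y. \<sigma> (inv s) y = 1}"
    using sigma_cocycle[of "inv s" _ x] x s by (auto simp: orbit_def)
  ultimately have "closure (orbit G act x) \<subseteq> {y. \<sigma> (inv s) y = 1}"
    by (rule closure_minimal[rotated])
  then have "\<sigma> (inv s) y = 1" for y
    using minimal by (auto simp: minimal_action_def)
  then show "translate act \<nu> s = \<nu>"
    using translate_inv_eq_density[of "inv s"] s by (simp add: density_1)
qed

lemma exists_SUP_moment_less_1: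
  assumes p: "0 < p" "p < 1" and not_inv: "\<not> invariant_measure G act \<nu>"
  shows "\<exists>n. (SUP x. moment p n x) < 1"
proof -
  \<comment> \<open>The sets where the moment reaches 1; passing to reals makes
    \<open>continuous_moment\<close> applicable, so they are closed.\<close>
  define K where "K n = {x. 1 \<le> enn2real (moment p n x)}" for n
  have fin: "moment p n x = ennreal (enn2real (moment p n x))" for n x
    using le_less_trans[OF moment_le_1[OF p] ennreal_one_less_top] by (simp add: ennreal_enn2real)
  have K_iff: "x \<in> K n \<longleftrightarrow> 1 \<le> moment p n x" for x n
    unfolding K_def by (subst (2) fin) (simp add: ennreal_ge_1)
  have closed_K: "closed (K n)" for n
    unfolding K_def by (intro closed_Collect_le continuous_moment p continuous_intros)
  have "decseq K"
  proof (rule decseq_SucI, rule subsetI)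
    fix n x assume "x \<in> K (Suc n)"
    then show "x \<in> K n" using moment_Suc_le[OF p, of n x] by (simp add: K_iff)
  qed
  have "(\<Inter>n. K n) = {}"
  proof (rule ccontr)
    assume "(\<Inter>n. K n) \<noteq> {}"
    then obtain x where "\<forall>n. 1 \<le> moment p n x" by (auto simp: K_iff)
    then have "\<sigma> s x = 1" if "s \<in> carrier G" for s
      using that sigma_eq_1_if_moment_ge_1[OF p, of _ x s]
      by (auto simp: carrier_eq_UN_set_pmf_convolution_power)
    then have "invariant_measure G act \<nu>" by (rule invariant_if_sigma_eq_1)
    with not_inv show False ..
  qed
  then have "UNIV \<inter> (\<Inter>n\<in>UNIV. K n) = {}" by simp
  then obtain N where N: "finite N" "UNIV \<inter> (\<Inter>n\<in>N. K n) = {}"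
    using compact_imp_fip_image[OF compact, of UNIV K] closed_K by metis
  \<comment> \<open>Inserting 0 keeps \<open>Max\<close> meaningful should \<open>N\<close> be
    empty.\<close>
  define n where "n = Max (insert 0 N)"
  have "K n \<subseteq> (\<Inter>m\<in>N. K m)"
    unfolding n_def using N(1) by (intro INT_greatest decseqD[OF \<open>decseq K\<close>]) simp
  then have empty: "K n = {}" using N(2) by simp
  \<comment> \<open>Emptiness of \<open>K n\<close> only gives a value below 1 at each point;
    attaining the maximum keeps the inequality strict for the supremum.\<close>
  obtain z where z: "\<And>x. enn2real (moment p n x) \<le> enn2real (moment p n z)"
    using continuous_attains_sup[OF compact _ continuous_moment[OF p, of n]] by auto
  have "(SUP x. moment p n x) \<le> moment p n z"
  proof (rule SUP_least)
    fix x
    have "ennreal (enn2real (moment p n x)) \<le> ennreal (enn2real (moment p n z))"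
      using z by (rule ennreal_leI)
    then show "moment p n x \<le> moment p n z" by (simp only: fin[symmetric])
  qed
  also have "\<dots> < 1" using empty K_iff[of z n] by (auto simp: not_le)
  finally show ?thesis by blast
qed

end

text \<open>The bound \<open>\<epsilon> < 1/2\<close> keeps the exponent positive. At
  \<open>\<epsilon> = 1/2\<close> every integral is 1, since the cocycle identity makes \<sigma>
  nonvanishing; for larger \<open>\<epsilon>\<close> convexity makes every integral at least
  1.\<close>

theorem proposition4p3:
  fixes G :: "('g, 'b) monoid_scheme" and \<mu> :: "'g pmf"
    and act :: "'g \<Rightarrow> 'x::topological_space \<Rightarrow> 'x" and \<nu> :: "'x measure"
    and \<sigma> :: "'g \<Rightarrow> 'x \<Rightarrow> real" and \<epsilon> :: real
  assumes "measured_group G \<mu>"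
    and "compact_stationary_space G \<mu> act \<nu>"
    and "minimal_action G act"
    and "\<And>s. s \<in> carrier G \<Longrightarrow> continuous_representative \<nu> (RN_cocycle G act \<nu> s) (\<sigma> s)"
    and "\<not> invariant_measure G act \<nu>"
    and "0 < \<epsilon>" and "\<epsilon> < 1/2"
  shows "\<exists>n::nat. (SUP x. \<integral>\<^sup>+ s. ennreal (\<sigma> s x powr (1 - 2 * \<epsilon>))
    \<partial>measure_pmf (convolution_power G \<mu> n)) < 1"
proof -
  interpret compact_stationary_space G \<mu> act \<nu> by fact
  interpret continuous_cocycle_space G \<mu> act \<nu> \<sigma>
    by unfold_locales (use assms in auto)
  show ?thesis
    using exists_SUP_moment_less_1[of "1 - 2 * \<epsilon>"] assms by (simp add: moment_def)
qed

end
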